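(* Let $n$ be a positive integer and let $\langle n^2\rangle=\sum_{a=1}^{n^2}e_a\otimes e_a\otimes e_a\in\bigotimes^3\mathbb{C}^{n^2}$ be the unit tensor. (1) $F_n(\langle n^2\rangle)$ equals the difference between the number of even Latin cubes of size $n$ and the number of odd Latin cubes of size $n$. (2) We have $F_n(\langle n^2\rangle)=0$ if $n$ is odd.
   Context: $[k]=\{1,\dots,k\}$. A total ordering of $[n]^3$ is fixed. The $x$-slices (resp. $y$-, $z$-slices) of $[n]^3$ are the $n$ subsets obtained by fixing the first (resp. second, third) coordinate; each inherits an ordering, so a map from a slice bijectively onto $[n^2]$ is a permutation with a well-defined sign. For $\alpha\colon[n]^3\to[n^2]$, $\mathrm{sgn}_x(\alpha)$ is the product of the signs of the restrictions of $\alpha$ to the $x$-slices if all these are bijections, and $0$ otherwise; $\mathrm{sgn}_y,\mathrm{sgn}_z$ are analogous. For $w=\sum_{a,b,c}w_{abc}\,e_a\otimes e_b\otimes e_c\in\bigotimes^3\mathbb{C}^{n^2}$, $$F_n(w)=\sum_{\alpha,\beta,\gamma\colon[n]^3\to[n^2]}\mathrm{sgn}_x(\alpha)\,\mathrm{sgn}_y(\beta)\,\mathrm{sgn}_z(\gamma)\prod_{p\in[n]^3}w_{\alpha(p)\beta(p)\gamma(p)}.$$ A Latin cube of size $n$ is a map $\alpha\colon[n]^3\to[n^2]$ that is a bijection on each $x$-slice, each $y$-slice and each $z$-slice. It is even if the product of the signs of the resulting permutations of all $x$-, $y$- and $z$-slices equals $1$, and odd otherwise.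
   Formalization: Part (2) is stated for odd n other than 1, because for n = 1 it fails: the only map on [1]^3 has all slice signs 1, so F_1 of the unit tensor equals 1. *)

theory Defs
  imports Complex_Main "HOL-Library.FuncSet" "HOL-Combinatorics.Permutations"
begin

type_synonym point = "nat \<times> nat \<times> nat"

definition cube :: "nat \<Rightarrow> point set" where
  "cube n = {1..n} \<times> {1..n} \<times> {1..n}"

definition xcoord :: "point \<Rightarrow> nat" where "xcoord p = fst p"
definition ycoord :: "point \<Rightarrow> nat" where "ycoord p = fst (snd p)"
definition zcoord :: "point \<Rightarrow> nat" where "zcoord p = snd (snd p)"

text \<open>The argument \<open>c\<close> is one of the three coordinate functions above.\<close>

definition slice :: "(point \<Rightarrow> nat) \<Rightarrow> nat \<Rightarrow> nat \<Rightarrow> point set" where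
  "slice c n i = {p \<in> cube n. c p = i}"

text \<open>Maps \<open>[n]\<^sup>3 \<rightarrow> [n\<^sup>2]\<close> are represented by extensional functions, so that there are
  finitely many of them and each occurs once.\<close>

definition labelings :: "nat \<Rightarrow> (point \<Rightarrow> nat) set" where
  "labelings n = cube n \<rightarrow>\<^sub>E {1..n^2}"

text \<open>\<open>r\<close> is the fixed total ordering, with \<open>(p, q) \<in> r\<close> meaning that \<open>p\<close> is at most \<open>q\<close>.
  The position of \<open>p\<close> in a finite set \<open>S\<close> with the inherited ordering is counted from \<open>1\<close>.\<close>

definition position :: "point rel \<Rightarrow> point set \<Rightarrow> point \<Rightarrow> nat" where
  "position r S p = card {q \<in> S. (q, p) \<in> r}"

text \<open>A bijection \<open>\<alpha>\<close> from \<open>S\<close> onto \<open>{1..card S}\<close> becomes the permutation sending \<open>k\<close> to the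
  value of \<open>\<alpha>\<close> at the \<open>k\<close>-th element of \<open>S\<close>, extended by the identity to all of \<open>nat\<close>.\<close>

definition induced_perm :: "point rel \<Rightarrow> point set \<Rightarrow> (point \<Rightarrow> nat) \<Rightarrow> nat \<Rightarrow> nat" where
  "induced_perm r S \<alpha> k =
     (if k \<in> {1..card S} then \<alpha> (the_inv_into S (position r S) k) else k)"

definition sgn_slices :: "point rel \<Rightarrow> (point \<Rightarrow> nat) \<Rightarrow> nat \<Rightarrow> (point \<Rightarrow> nat) \<Rightarrow> int" where
  "sgn_slices r c n \<alpha> =
     (if \<forall>i\<in>{1..n}. bij_betw \<alpha> (slice c n i) {1..n^2}
      then \<Prod>i\<in>{1..n}. sign (induced_perm r (slice c n i) \<alpha>)
      else 0)"

text \<open>A tensor in the third tensor power of \<open>\<complex>\<^sup>m\<close> is given by its coordinates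
  \<open>w a b c\<close> in the standard basis, where \<open>a\<close>, \<open>b\<close>, \<open>c\<close> range over \<open>{1..m}\<close>.\<close>

type_synonym tensor3 = "nat \<Rightarrow> nat \<Rightarrow> nat \<Rightarrow> complex"

definition basis_vec :: "nat \<Rightarrow> nat \<Rightarrow> complex" where
  "basis_vec a = (\<lambda>j. if j = a then 1 else 0)"

definition simple_tensor ::
    "(nat \<Rightarrow> complex) \<Rightarrow> (nat \<Rightarrow> complex) \<Rightarrow> (nat \<Rightarrow> complex) \<Rightarrow> tensor3" where
  "simple_tensor u v w = (\<lambda>a b c. u a * v b * w c)"

definition unit_tensor :: "nat \<Rightarrow> tensor3" where
  "unit_tensor m =
     (\<lambda>a b c. \<Sum>i\<in>{1..m}. simple_tensor (basis_vec i) (basis_vec i) (basis_vec i) a b c)"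

definition F :: "point rel \<Rightarrow> nat \<Rightarrow> tensor3 \<Rightarrow> complex" where
  "F r n w =
     (\<Sum>\<alpha>\<in>labelings n. \<Sum>\<beta>\<in>labelings n. \<Sum>\<gamma>\<in>labelings n.
        of_int (sgn_slices r xcoord n \<alpha> * sgn_slices r ycoord n \<beta> * sgn_slices r zcoord n \<gamma>) *
        (\<Prod>p\<in>cube n. w (\<alpha> p) (\<beta> p) (\<gamma> p)))"

definition latin_cubes :: "nat \<Rightarrow> (point \<Rightarrow> nat) set" where
  "latin_cubes n =
     {\<alpha> \<in> labelings n. \<forall>c\<in>{xcoord, ycoord, zcoord}. \<forall>i\<in>{1..n}.
        bij_betw \<alpha> (slice c n i) {1..n^2}}"

definition latin_sign :: "point rel \<Rightarrow> nat \<Rightarrow> (point \<Rightarrow> nat) \<Rightarrow> int" where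
  "latin_sign r n \<alpha> =
     (\<Prod>i\<in>{1..n}. sign (induced_perm r (slice xcoord n i) \<alpha>)) *
     (\<Prod>i\<in>{1..n}. sign (induced_perm r (slice ycoord n i) \<alpha>)) *
     (\<Prod>i\<in>{1..n}. sign (induced_perm r (slice zcoord n i) \<alpha>))"

definition even_latin_cubes :: "point rel \<Rightarrow> nat \<Rightarrow> (point \<Rightarrow> nat) set" where
  "even_latin_cubes r n = {\<alpha> \<in> latin_cubes n. latin_sign r n \<alpha> = 1}"

definition odd_latin_cubes :: "point rel \<Rightarrow> nat \<Rightarrow> (point \<Rightarrow> nat) set" where
  "odd_latin_cubes r n = {\<alpha> \<in> latin_cubes n. latin_sign r n \<alpha> \<noteq> 1}"

end

theory Submission
  imports Defs
begin

text \<open>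
  All entries of the unit tensor off the diagonal are \<open>0\<close>, so a summand of \<open>F\<close> survives only if
  \<open>\<alpha> = \<beta> = \<gamma>\<close>, and then its weight is the product of the three slice signs of one labelling.
  That product is nonzero precisely for Latin cubes, where it is the sign of the cube: this gives
  \<open>F_unit_tensor\<close>, and sorting the cubes by their sign gives the first claim.

  For the second claim, exchange the labels \<open>1\<close> and \<open>2\<close>; there are two labels because
  \<open>n \<noteq> 1\<close>.  This composes the permutation of each of the \<open>3 n\<close> slices with a transposition, so
  the sign of a Latin cube is multiplied by \<open>(-1) ^ (3 * n)\<close>, which is \<open>-1\<close> for odd \<open>n\<close>.  The
  exchange is thus a sign-reversing involution on the set of Latin cubes, and the signed count
  vanishes.

  The linear order enters through \<open>bij_betw_position\<close>: because \<open>position r S\<close> numbers the elements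
  of \<open>S\<close> from \<open>1\<close> to \<open>card S\<close>, composing a labelling with a transposition composes the induced
  function on \<open>nat\<close> with it, and this function is a permutation, so that its sign is
  multiplicative.
\<close>

section \<open>The unit tensor and the signed count of Latin cubes\<close>

lemma finite_cube [simp]: "finite (cube n)"
  by (simp add: cube_def)

lemma finite_labelings [simp]: "finite (labelings n)"
  by (simp add: labelings_def finite_PiE)

lemma finite_latin_cubes [simp]: "finite (latin_cubes n)"
  by (rule finite_subset [OF _ finite_labelings]) (auto simp: latin_cubes_def)

lemma unit_tensor_eq:
  assumes "a \<in> {1..m}"
  shows "unit_tensor m a b c = (if b = a \<and> c = a then 1 else 0)"
proof -
  have "unit_tensor m a b c = (\<Sum>i\<in>{1..m}. if a = i then (if b = a \<and> c = a then 1 else 0) else 0)"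
    unfolding unit_tensor_def simple_tensor_def basis_vec_def
    by (rule sum.cong) auto
  with assms show ?thesis
    by simp
qed

text \<open>The product is over the whole cube, and labellings take one fixed value outside it, so
  equality at every point of the cube is equality of functions.\<close>

lemma prod_unit_tensor:
  assumes "\<alpha> \<in> labelings n" "\<beta> \<in> labelings n" "\<gamma> \<in> labelings n"
  shows "(\<Prod>p\<in>cube n. unit_tensor (n^2) (\<alpha> p) (\<beta> p) (\<gamma> p)) =
           (if \<beta> = \<alpha> \<and> \<gamma> = \<alpha> then 1 else 0)"
proof -
  have "(\<Prod>p\<in>cube n. unit_tensor (n^2) (\<alpha> p) (\<beta> p) (\<gamma> p)) =
          (\<Prod>p\<in>cube n. if \<beta> p = \<alpha> p \<and> \<gamma> p = \<alpha> p then 1 else 0)"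
    using assms(1) by (intro prod.cong refl unit_tensor_eq) (auto simp: labelings_def)
  also have "\<dots> = (if \<forall>p\<in>cube n. \<beta> p = \<alpha> p \<and> \<gamma> p = \<alpha> p then 1 else 0)"
    by (auto intro!: prod.neutral)
  also have "(\<forall>p\<in>cube n. \<beta> p = \<alpha> p \<and> \<gamma> p = \<alpha> p) \<longleftrightarrow> \<beta> = \<alpha> \<and> \<gamma> = \<alpha>"
    using assms unfolding labelings_def by (metis PiE_ext)
  finally show ?thesis .
qed

lemma sgn_slices_product:
  assumes "\<alpha> \<in> labelings n"
  shows "sgn_slices r xcoord n \<alpha> * sgn_slices r ycoord n \<alpha> * sgn_slices r zcoord n \<alpha> =
           (if \<alpha> \<in> latin_cubes n then latin_sign r n \<alpha> else 0)"
  using assms by (auto simp: sgn_slices_def latin_cubes_def latin_sign_def)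

lemma F_unit_tensor:
  "F r n (unit_tensor (n^2)) = of_int (\<Sum>\<alpha>\<in>latin_cubes n. latin_sign r n \<alpha>)"
proof -
  define g where "g \<alpha> \<beta> \<gamma> = (of_int (sgn_slices r xcoord n \<alpha> * sgn_slices r ycoord n \<beta> *
    sgn_slices r zcoord n \<gamma>) :: complex)" for \<alpha> \<beta> \<gamma>
  have "F r n (unit_tensor (n^2)) = (\<Sum>\<alpha>\<in>labelings n. \<Sum>\<beta>\<in>labelings n. \<Sum>\<gamma>\<in>labelings n.
          if \<gamma> = \<alpha> then (if \<beta> = \<alpha> then g \<alpha> \<beta> \<gamma> else 0) else 0)"
    unfolding F_def g_def by (intro sum.cong refl) (simp add: prod_unit_tensor)
  also have "\<dots> = (\<Sum>\<alpha>\<in>labelings n. g \<alpha> \<alpha> \<alpha>)"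
    by simp
  also have "\<dots> = of_int (\<Sum>\<alpha>\<in>labelings n. if \<alpha> \<in> latin_cubes n then latin_sign r n \<alpha> else 0)"
    unfolding g_def of_int_sum by (intro sum.cong refl) (simp add: sgn_slices_product)
  also have "(\<Sum>\<alpha>\<in>labelings n. if \<alpha> \<in> latin_cubes n then latin_sign r n \<alpha> else 0) =
               (\<Sum>\<alpha>\<in>latin_cubes n. latin_sign r n \<alpha>)"
    by (rule sum.mono_neutral_cong_right) (auto simp: latin_cubes_def)
  finally show ?thesis .
qed

lemma abs_latin_sign: "\<bar>latin_sign r n \<alpha>\<bar> = 1"
proof -
  have "\<bar>\<Prod>i\<in>I. sign (p i) :: int\<bar> = 1" for I :: "nat set" and p :: "nat \<Rightarrow> nat \<Rightarrow> nat"
    by (induction I rule: infinite_finite_induct) (simp_all add: abs_mult)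
  then show ?thesis
    by (simp only: latin_sign_def abs_mult mult_1)
qed

text \<open>A sign is \<open>1\<close> or \<open>-1\<close>, so the odd cubes, those whose sign is not \<open>1\<close>, each contribute
  \<open>-1\<close>.\<close>

lemma sum_latin_sign:
  "(\<Sum>\<alpha>\<in>latin_cubes n. latin_sign r n \<alpha>) =
     int (card (even_latin_cubes r n)) - int (card (odd_latin_cubes r n))"
proof -
  have split: "latin_cubes n = even_latin_cubes r n \<union> odd_latin_cubes r n"
    and fin: "finite (even_latin_cubes r n)" "finite (odd_latin_cubes r n)"
    and disj: "even_latin_cubes r n \<inter> odd_latin_cubes r n = {}"
    by (auto simp: even_latin_cubes_def odd_latin_cubes_def)
  have "(\<Sum>\<alpha>\<in>even_latin_cubes r n. latin_sign r n \<alpha>) = (\<Sum>\<alpha>\<in>even_latin_cubes r n. 1)"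
    by (rule sum.cong) (auto simp: even_latin_cubes_def)
  moreover have "(\<Sum>\<alpha>\<in>odd_latin_cubes r n. latin_sign r n \<alpha>) = (\<Sum>\<alpha>\<in>odd_latin_cubes r n. -1)"
  proof (rule sum.cong)
    fix \<alpha> assume "\<alpha> \<in> odd_latin_cubes r n"
    then show "latin_sign r n \<alpha> = -1"
      using abs_latin_sign [of r n \<alpha>] by (auto simp: odd_latin_cubes_def abs_if split: if_splits)
  qed simp
  ultimately show ?thesis
    by (simp add: split sum.union_disjoint fin disj)
qed

section \<open>Permutations induced by a linear order\<close>

text \<open>Along a linear order the sets of predecessors grow strictly, so positions are distinct;
  they lie between \<open>1\<close>, by reflexivity, and \<open>card S\<close>, so they exhaust this range.\<close>

lemma bij_betw_position:
  assumes "linear_order_on A r" "S \<subseteq> A" "finite S"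
  shows "bij_betw (position r S) S {1..card S}"
proof -
  have refl: "(p, p) \<in> r" if "p \<in> S" for p
    using assms that
    by (auto simp: order_on_defs refl_on_def)
  have trans: "trans r" and antisym: "antisym r" and total: "total_on A r"
    using assms by (auto simp: order_on_defs)
  have less: "position r S p < position r S q" if "p \<in> S" "q \<in> S" "p \<noteq> q" "(p, q) \<in> r" for p q
    unfolding position_def
  proof (rule psubset_card_mono)
    have "{x \<in> S. (x, p) \<in> r} \<subseteq> {x \<in> S. (x, q) \<in> r}"
      using that(4) trans by (auto dest: transD)
    moreover have "q \<notin> {x \<in> S. (x, p) \<in> r}"
      using that antisym by (auto dest: antisymD)
    moreover have "q \<in> {x \<in> S. (x, q) \<in> r}"
      using that(2) refl by blast
    ultimately show "{x \<in> S. (x, p) \<in> r} \<subset> {x \<in> S. (x, q) \<in> r}"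
      by blast
  qed (use assms in simp)
  have "(p, q) \<in> r \<or> (q, p) \<in> r" if "p \<in> S" "q \<in> S" "p \<noteq> q" for p q
    using total that assms(2) by (auto simp: total_on_def)
  with less have inj: "inj_on (position r S) S"
    by (intro inj_onI) (metis less_irrefl)
  have "position r S p \<in> {1..card S}" if "p \<in> S" for p
  proof -
    have "{q \<in> S. (q, p) \<in> r} \<noteq> {}"
      using refl that by blast
    then have "card {q \<in> S. (q, p) \<in> r} > 0"
      using assms(3) by (simp add: card_gt_0_iff)
    moreover have "card {q \<in> S. (q, p) \<in> r} \<le> card S"
      using assms(3) by (intro card_mono) auto
    ultimately show ?thesis
      by (simp add: position_def)
  qed
  then have "position r S ` S = {1..card S}"
    by (intro card_subset_eq) (auto simp: card_image inj)
  with inj show ?thesis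
    by (simp add: bij_betw_def)
qed

lemma induced_perm_permutes:
  assumes "bij_betw (position r S) S {1..card S}" "bij_betw \<alpha> S {1..card S}"
  shows "induced_perm r S \<alpha> permutes {1..card S}"
proof (rule bij_imp_permutes)
  have "bij_betw (\<alpha> \<circ> the_inv_into S (position r S)) {1..card S} {1..card S}"
    using bij_betw_the_inv_into [OF assms(1)] assms(2) by (rule bij_betw_trans)
  then show "bij_betw (induced_perm r S \<alpha>) {1..card S} {1..card S}"
    by (rule bij_betw_cong [THEN iffD1, rotated]) (simp add: induced_perm_def)
qed (simp only: induced_perm_def if_False)

lemma induced_perm_comp:
  assumes "bij_betw (position r S) S {1..card S}" "\<tau> permutes {1..card S}"
    and "\<And>p. p \<in> S \<Longrightarrow> \<beta> p = \<tau> (\<alpha> p)"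
  shows "induced_perm r S \<beta> = \<tau> \<circ> induced_perm r S \<alpha>"
proof
  fix k
  show "induced_perm r S \<beta> k = (\<tau> \<circ> induced_perm r S \<alpha>) k"
  proof (cases "k \<in> {1..card S}")
    case True
    then have "the_inv_into S (position r S) k \<in> S"
      using bij_betw_the_inv_into [OF assms(1)] by (rule bij_betwE [rule_format, rotated])
    with True assms(3) show ?thesis
      by (simp add: induced_perm_def)
  next
    case False
    with permutes_not_in [OF assms(2) False] show ?thesis
      unfolding induced_perm_def comp_def by (simp only: if_False)
  qed
qed

lemma sign_induced_perm_comp:
  assumes "bij_betw (position r S) S {1..card S}" "bij_betw \<alpha> S {1..card S}"
    and "\<tau> permutes {1..card S}" "\<And>p. p \<in> S \<Longrightarrow> \<beta> p = \<tau> (\<alpha> p)"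
  shows "sign (induced_perm r S \<beta>) = sign \<tau> * sign (induced_perm r S \<alpha>)"
proof -
  have "permutation \<tau>" "permutation (induced_perm r S \<alpha>)"
    using assms(3) induced_perm_permutes [OF assms(1,2)]
    by (auto simp: permutation_permutes intro: finite_atLeastAtMost)
  with induced_perm_comp [OF assms(1,3,4)] show ?thesis
    by (simp add: sign_compose)
qed

section \<open>Exchanging two labels\<close>

definition relabel :: "nat \<Rightarrow> (nat \<Rightarrow> nat) \<Rightarrow> (point \<Rightarrow> nat) \<Rightarrow> point \<Rightarrow> nat" where
  "relabel n \<tau> \<alpha> = compose (cube n) \<tau> \<alpha>"

lemma slice_subset_cube: "slice c n i \<subseteq> cube n"
  by (auto simp: slice_def)

lemma relabel_on_slice: "p \<in> slice c n i \<Longrightarrow> relabel n \<tau> \<alpha> p = \<tau> (\<alpha> p)"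
  by (simp add: relabel_def compose_def slice_def)

lemma relabel_in_latin_cubes:
  assumes "\<tau> permutes {1..n^2}" "\<alpha> \<in> latin_cubes n"
  shows "relabel n \<tau> \<alpha> \<in> latin_cubes n"
proof -
  have "relabel n \<tau> \<alpha> \<in> labelings n"
    using assms unfolding relabel_def latin_cubes_def labelings_def compose_def
    by (auto simp: permutes_in_image simp del: atLeastAtMost_iff)
  moreover have "bij_betw (relabel n \<tau> \<alpha>) (slice c n i) {1..n^2}"
    if "bij_betw \<alpha> (slice c n i) {1..n^2}" for c i
  proof -
    have "bij_betw (\<tau> \<circ> \<alpha>) (slice c n i) {1..n^2}"
      using that permutes_imp_bij [OF assms(1)] by (rule bij_betw_trans)
    then show ?thesis
      by (rule bij_betw_cong [THEN iffD1, rotated]) (simp add: relabel_on_slice)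
  qed
  ultimately show ?thesis
    using assms(2) by (simp add: latin_cubes_def)
qed

lemma relabel_relabel:
  assumes "\<alpha> \<in> labelings n" "\<tau> \<circ> \<tau> = id"
  shows "relabel n \<tau> (relabel n \<tau> \<alpha>) = \<alpha>"
proof -
  have "\<tau> (\<tau> k) = k" for k
    using assms(2) by (metis comp_apply id_apply)
  with assms(1) show ?thesis
    by (auto simp: relabel_def compose_def labelings_def PiE_def extensional_def fun_eq_iff)
qed

text \<open>Each of the \<open>3 * n\<close> slice permutations picks up the factor \<open>sign \<tau>\<close>.\<close>

lemma latin_sign_relabel:
  assumes "linear_order_on (cube n) r" "\<tau> permutes {1..n^2}" "\<alpha> \<in> latin_cubes n"
  shows "latin_sign r n (relabel n \<tau> \<alpha>) = sign \<tau> ^ (3 * n) * latin_sign r n \<alpha>"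
proof -
  have prod_eq: "(\<Prod>i\<in>{1..n}. sign (induced_perm r (slice c n i) (relabel n \<tau> \<alpha>))) =
        sign \<tau> ^ n * (\<Prod>i\<in>{1..n}. sign (induced_perm r (slice c n i) \<alpha>))"
    if "c \<in> {xcoord, ycoord, zcoord}" for c
  proof -
    have "sign (induced_perm r (slice c n i) (relabel n \<tau> \<alpha>)) =
            sign \<tau> * sign (induced_perm r (slice c n i) \<alpha>)" if i: "i \<in> {1..n}" for i
    proof -
      have bij: "bij_betw \<alpha> (slice c n i) {1..n^2}"
        using assms(3) \<open>c \<in> {xcoord, ycoord, zcoord}\<close> i by (auto simp: latin_cubes_def)
      then have card: "card (slice c n i) = n^2"
        using bij_betw_same_card by fastforce
      have pos: "bij_betw (position r (slice c n i)) (slice c n i) {1..card (slice c n i)}"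
        using assms(1) slice_subset_cube finite_subset [OF slice_subset_cube finite_cube]
        by (rule bij_betw_position)
      show ?thesis
        using sign_induced_perm_comp [OF pos, unfolded card, OF bij assms(2)] relabel_on_slice
        by blast
    qed
    then have "(\<Prod>i\<in>{1..n}. sign (induced_perm r (slice c n i) (relabel n \<tau> \<alpha>))) =
        (\<Prod>i\<in>{1..n}. sign \<tau> * sign (induced_perm r (slice c n i) \<alpha>))"
      by (intro prod.cong) auto
    then show ?thesis
      by (simp add: prod.distrib)
  qed
  have "sign \<tau> ^ (3 * n) = sign \<tau> ^ n * sign \<tau> ^ n * sign \<tau> ^ n"
    by (simp add: eval_nat_numeral algebra_simps power_add)
  then show ?thesis
    by (simp only: latin_sign_def prod_eq insert_iff simp_thms mult_ac)
qed

lemma sum_latin_sign_odd: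
  assumes "linear_order_on (cube n) r" "odd n" "n \<noteq> 1"
  shows "(\<Sum>\<alpha>\<in>latin_cubes n. latin_sign r n \<alpha>) = 0"
proof -
  define \<tau> where "\<tau> = transpose (1::nat) 2"
  have "2 \<le> n"
    using assms(2,3) by (cases n) auto
  then have "2 \<le> n^2"
    using self_le_power [of n 2] by linarith
  then have perm: "\<tau> permutes {1..n^2}"
    unfolding \<tau>_def by (intro permutes_swap_id) auto
  have sign: "sign \<tau> = -1"
    by (simp add: \<tau>_def sign_swap_id)
  have inv: "relabel n \<tau> (relabel n \<tau> \<alpha>) = \<alpha>" if "\<alpha> \<in> latin_cubes n" for \<alpha>
    using that by (intro relabel_relabel) (auto simp: \<tau>_def latin_cubes_def)
  have "(\<Sum>\<alpha>\<in>latin_cubes n. latin_sign r n \<alpha>) = (\<Sum>\<alpha>\<in>latin_cubes n. - latin_sign r n \<alpha>)"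
  proof (rule sum.reindex_bij_witness [where i = "relabel n \<tau>" and j = "relabel n \<tau>"])
    fix \<alpha> assume "\<alpha> \<in> latin_cubes n"
    then show "- latin_sign r n (relabel n \<tau> \<alpha>) = latin_sign r n \<alpha>"
      using assms(2) by (simp add: latin_sign_relabel [OF assms(1) perm] sign)
  qed (simp_all add: inv relabel_in_latin_cubes [OF perm])
  then show ?thesis
    by (simp add: sum_negf)
qed

theorem proposition5p22:
  fixes n :: nat and r :: "point rel"
  assumes "n > 0"
    and "linear_order_on (cube n) r"
  shows "F r n (unit_tensor (n^2)) =
           of_nat (card (even_latin_cubes r n)) - of_nat (card (odd_latin_cubes r n))
         \<and> (odd n \<and> n \<noteq> 1 \<longrightarrow> F r n (unit_tensor (n^2)) = 0)"
proof (intro conjI impI)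
  show "F r n (unit_tensor (n^2)) =
          of_nat (card (even_latin_cubes r n)) - of_nat (card (odd_latin_cubes r n))"
    by (simp add: F_unit_tensor sum_latin_sign)
next
  assume "odd n \<and> n \<noteq> 1"
  then show "F r n (unit_tensor (n^2)) = 0"
    using sum_latin_sign_odd [OF assms(2)] by (simp add: F_unit_tensor)
qed

end
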